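(* For any positive integer $n$, $$\sum_{\alpha \in S_n} \prod_{j=1}^n \frac{1}{\alpha_j!\, j^{\alpha_j}} = 1,$$ where the summation runs over the set $S_n$ of all $\alpha = (\alpha_1, \alpha_2, \dots, \alpha_n) \in \mathbb{N}^n$ such that $$\sum_{j=1}^n j\,\alpha_j = n.$$
   Context: Here $\mathbb{N} = \{0, 1, 2, \dots\}$ denotes the set of nonnegative integers (including $0$). *)

theory Defs
  imports Complex_Main "HOL-Library.FuncSet"
begin

(* A tuple in N^n is an extensional function on {1..n}, so that distinct members of the
   set are distinct tuples. *)
definition S :: "nat \<Rightarrow> (nat \<Rightarrow> nat) set" where
  "S n = {\<alpha> \<in> {1..n} \<rightarrow>\<^sub>E (UNIV :: nat set). (\<Sum>j=1..n. j * \<alpha> j) = n}"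

(* Finiteness matters because a sum over an infinite set is 0 by convention. *)
lemma finite_S: "finite (S n)"
proof (rule finite_subset)
  show "S n \<subseteq> {1..n} \<rightarrow>\<^sub>E {0..n}"
  proof
    fix \<alpha> assume a: "\<alpha> \<in> S n"
    have "\<alpha> j \<le> n" if j: "j \<in> {1..n}" for j
    proof -
      have "\<alpha> j \<le> j * \<alpha> j" using j by simp
      also have "\<dots> \<le> (\<Sum>j=1..n. j * \<alpha> j)"
        by (rule member_le_sum[OF j]) auto
      also have "\<dots> = n" using a by (simp add: S_def)
      finally show ?thesis .
    qed
    then show "\<alpha> \<in> {1..n} \<rightarrow>\<^sub>E {0..n}"
      using a by (auto simp: S_def PiE_iff)
  qed
qed (simp add: finite_PiE)

end

theory Submission
  imports Defs
begin

(* Multiply the weight of each \<alpha> by m = \<Sum>j. j * \<alpha> j. Since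
   k * \<alpha> k * weight \<alpha> is the weight of \<alpha> with its k-th entry lowered by 1, the total
   weights a m over tuples of fixed length N satisfy m * a m = a (m - 1) + ... + a 0
   for m \<le> N, and a 0 = 1 forces a m = 1. In terms of permutations, this marks a point
   and removes the cycle through it. *)

definition cycle_types :: "nat \<Rightarrow> nat \<Rightarrow> (nat \<Rightarrow> nat) set" where
  "cycle_types N m = {\<alpha> \<in> {1..N} \<rightarrow>\<^sub>E (UNIV :: nat set). (\<Sum>j=1..N. j * \<alpha> j) = m}"

text \<open>For \<alpha> in \<open>cycle_types N m\<close> with m \<le> N, m! times this is the
  number of permutations of m points with \<open>\<alpha> j\<close> cycles of length j for each
  j.\<close>

definition weight :: "nat \<Rightarrow> (nat \<Rightarrow> nat) \<Rightarrow> real" where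
  "weight N \<alpha> = (\<Prod>j=1..N. 1 / (fact (\<alpha> j) * real j ^ \<alpha> j))"

lemma cycle_types_entry_le:
  assumes "\<alpha> \<in> cycle_types N m" "k \<in> {1..N}"
  shows "k * \<alpha> k \<le> m"
proof -
  have "k * \<alpha> k \<le> (\<Sum>j=1..N. j * \<alpha> j)"
    by (rule member_le_sum[OF assms(2)]) auto
  then show ?thesis using assms(1) by (simp add: cycle_types_def)
qed

lemma finite_cycle_types: "finite (cycle_types N m)"
proof (rule finite_subset)
  show "cycle_types N m \<subseteq> {1..N} \<rightarrow>\<^sub>E {0..m}"
  proof
    fix \<alpha> assume a: "\<alpha> \<in> cycle_types N m"
    have "\<alpha> j \<le> m" if j: "j \<in> {1..N}" for j
    proof -
      have "\<alpha> j \<le> j * \<alpha> j" using j by simp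
      also note cycle_types_entry_le[OF a j]
      finally show ?thesis .
    qed
    then show "\<alpha> \<in> {1..N} \<rightarrow>\<^sub>E {0..m}"
      using a by (auto simp: cycle_types_def PiE_iff)
  qed
qed (simp add: finite_PiE)

lemma cycle_types_0: "cycle_types N 0 = {\<lambda>j\<in>{1..N}. 0}"
  by (auto simp: cycle_types_def PiE_iff extensional_def restrict_def fun_eq_iff)

text \<open>Raising an entry avoids truncated subtraction; the effect of lowering is read off by
  applying this to the lowered tuple.\<close>

lemma weighted_sum_Suc_entry:
  assumes "k \<in> {1..N}"
  shows "(\<Sum>j=1..N. j * (\<beta>(k := Suc (\<beta> k))) j) = (\<Sum>j=1..N. j * \<beta> j) + k"
proof -
  have "(\<Sum>j\<in>{1..N} - {k}. j * (\<beta>(k := Suc (\<beta> k))) j) = (\<Sum>j\<in>{1..N} - {k}. j * \<beta> j)"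
    by (rule sum.cong) auto
  then show ?thesis
    by (simp only: sum.remove[OF finite_atLeastAtMost assms]) simp
qed

text \<open>Only the k-th factor changes: its factorial gains \<open>Suc (\<beta> k)\<close> and its
  power gains k, which is nonzero and so cancels.\<close>

lemma weight_Suc_entry:
  assumes "k \<in> {1..N}"
  shows "real k * real (Suc (\<beta> k)) * weight N (\<beta>(k := Suc (\<beta> k))) = weight N \<beta>"
proof -
  have "(\<Prod>j\<in>{1..N} - {k}. 1 / (fact ((\<beta>(k := Suc (\<beta> k))) j) * real j ^ (\<beta>(k := Suc (\<beta> k))) j))
      = (\<Prod>j\<in>{1..N} - {k}. 1 / (fact (\<beta> j) * real j ^ \<beta> j))"
    by (rule prod.cong) auto
  then show ?thesis
    using assms by (simp only: weight_def prod.remove[OF finite_atLeastAtMost assms])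
      (simp add: field_simps del: of_nat_Suc)
qed

text \<open>Removing one k-cycle is a bijection from the tuples with a nonzero k-th entry onto
  \<open>cycle_types N (m - k)\<close>, and the factor \<open>k * \<alpha> k\<close> is exactly the
  change in weight.\<close>

lemma sum_marked_weight:
  assumes k: "k \<in> {1..N}" and "k \<le> m"
  shows "(\<Sum>\<alpha>\<in>cycle_types N m. real (k * \<alpha> k) * weight N \<alpha>)
    = sum (weight N) (cycle_types N (m - k))"
proof -
  \<comment> \<open>Tuples without a k-cycle contribute 0; they must go before the bijection, since
    their k-th entry cannot be lowered.\<close>
  have "(\<Sum>\<alpha>\<in>cycle_types N m. real (k * \<alpha> k) * weight N \<alpha>)
      = (\<Sum>\<alpha>\<in>{\<alpha> \<in> cycle_types N m. \<alpha> k \<noteq> 0}. real (k * \<alpha> k) * weight N \<alpha>)"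
    by (rule sum.mono_neutral_right) (auto simp: finite_cycle_types)
  also have "\<dots> = sum (weight N) (cycle_types N (m - k))"
  proof (rule sum.reindex_bij_witness[where i = "\<lambda>\<beta>. \<beta>(k := Suc (\<beta> k))"
        and j = "\<lambda>\<alpha>. \<alpha>(k := \<alpha> k - 1)"])
    fix \<alpha> assume a: "\<alpha> \<in> {\<alpha> \<in> cycle_types N m. \<alpha> k \<noteq> 0}"
    let ?\<beta> = "\<alpha>(k := \<alpha> k - 1)"
    \<comment> \<open>As \<open>\<alpha> k\<close> is nonzero, the predecessor is exact, so the
      facts about raising apply to \<open>?\<beta>\<close>.\<close>
    from a have raise: "?\<beta>(k := Suc (?\<beta> k)) = \<alpha>"
      by auto
    then show "?\<beta>(k := Suc (?\<beta> k)) = \<alpha>" .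
    show "?\<beta> \<in> cycle_types N (m - k)"
      using a k weighted_sum_Suc_entry[OF k, of ?\<beta>] unfolding raise
      by (auto simp: cycle_types_def PiE_iff extensional_def)
    show "weight N ?\<beta> = real (k * \<alpha> k) * weight N \<alpha>"
      using a weight_Suc_entry[OF k, of ?\<beta>] unfolding raise by simp
  next
    fix \<beta> assume b: "\<beta> \<in> cycle_types N (m - k)"
    then show "\<beta>(k := Suc (\<beta> k)) \<in> {\<alpha> \<in> cycle_types N m. \<alpha> k \<noteq> 0}"
      using weighted_sum_Suc_entry[OF k, of \<beta>] k \<open>k \<le> m\<close>
      by (auto simp: cycle_types_def PiE_iff extensional_def simp del: fun_upd_apply)
         (auto simp: fun_upd_apply)
  qed auto
  finally show ?thesis .
qed

lemma sum_weight_recurrence: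
  assumes "m \<le> N"
  shows "real m * sum (weight N) (cycle_types N m)
    = (\<Sum>k=1..m. sum (weight N) (cycle_types N (m - k)))"
proof -
  \<comment> \<open>On every tuple of the sum, m is the total of \<open>k * \<alpha> k\<close>; this
    splits the marked point by the length k of its cycle.\<close>
  have "real m * sum (weight N) (cycle_types N m)
      = (\<Sum>\<alpha>\<in>cycle_types N m. real (\<Sum>k=1..N. k * \<alpha> k) * weight N \<alpha>)"
    by (simp add: sum_distrib_left cycle_types_def del: of_nat_sum)
  also have "\<dots> = (\<Sum>\<alpha>\<in>cycle_types N m. \<Sum>k=1..N. real (k * \<alpha> k) * weight N \<alpha>)"
    by (simp add: sum_distrib_right)
  also have "\<dots> = (\<Sum>k=1..N. \<Sum>\<alpha>\<in>cycle_types N m. real (k * \<alpha> k) * weight N \<alpha>)"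
    by (rule sum.swap)
  \<comment> \<open>No cycle is longer than m, so the lengths k with m < k \<le> N contribute
    0.\<close>
  also have "\<dots> = (\<Sum>k=1..m. \<Sum>\<alpha>\<in>cycle_types N m. real (k * \<alpha> k) * weight N \<alpha>)"
  proof (rule sum.mono_neutral_right)
    have "\<alpha> k = 0" if "k \<in> {1..N} - {1..m}" "\<alpha> \<in> cycle_types N m" for k \<alpha>
      using cycle_types_entry_le[of \<alpha> N m k] that by (cases "\<alpha> k") auto
    then show "\<forall>k\<in>{1..N} - {1..m}.
        (\<Sum>\<alpha>\<in>cycle_types N m. real (k * \<alpha> k) * weight N \<alpha>) = 0"
      by (auto intro!: sum.neutral)
  qed (use assms in auto)
  also have "\<dots> = (\<Sum>k=1..m. sum (weight N) (cycle_types N (m - k)))"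
    using assms by (intro sum.cong sum_marked_weight) auto
  finally show ?thesis .
qed

lemma sum_weight_eq_1:
  assumes "m \<le> N"
  shows "sum (weight N) (cycle_types N m) = 1"
  using assms
proof (induction m rule: less_induct)
  case (less m)
  show ?case
  proof (cases "m = 0")
    case True
    \<comment> \<open>Only the zero tuple remains, and each of its factors is 1 / (0! * j^0) =
      1.\<close>
    then show ?thesis by (simp add: cycle_types_0 weight_def)
  next
    case False
    \<comment> \<open>Since k \<ge> 1, each m - k is below m and the induction hypothesis turns all
      m terms into 1; then m cancels.\<close>
    have "real m * sum (weight N) (cycle_types N m) = (\<Sum>k=1..m. 1)"
      unfolding sum_weight_recurrence[OF less.prems]
      using less.prems by (intro sum.cong less.IH) auto
    with False show ?thesis by simp
  qed
qed

theorem mainTheorem1: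
  fixes n :: nat
  assumes "n > 0"
  shows "(\<Sum>\<alpha>\<in>S n. \<Prod>j=1..n. 1 / (fact (\<alpha> j) * real j ^ \<alpha> j)) = (1 :: real)"
  using sum_weight_eq_1[of n n] by (simp add: S_def cycle_types_def weight_def)

end
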